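(* Let $\gamma=\{\gamma_n\}_{n=0}^\infty$ be a sequence of positive real numbers. Then $\gamma$ is a central index preserver if and only if $\gamma$ is log-concave.
   Context: For a sequence $\gamma=\{\gamma_n\}_{n=0}^\infty$ of real numbers, $T_\gamma\colon\mathbb{R}[z]\to\mathbb{R}[z]$ denotes the linear operator with $T_\gamma[z^n]=\gamma_n z^n$ for all $n\ge 0$. Standing convention: the polynomials $f(z)=\sum_{n=0}^d a_n z^n$ considered have coefficients $a_n\ge 0$ (the notions below depend only on $|a_n|$). Coefficients $a_n$ with $n>d$ are $0$, and $z^0=1$ also for $z=0$. A non-negative integer $m$ is a central index of $f(z)=\sum_n a_n z^n$ if there exists a real number $z_m\ge 0$ such that $|a_m| z_m^m \ge \sum_{n\ne m} |a_n| z_m^n$. The sequence $\gamma$ is a central index preserver if for each polynomial $f$ the set of central indices of $f$ is a subset of the set of central indices of $T_\gamma[f]$. A positive sequence $\gamma$ is log-concave if $\gamma_n^2\ge\gamma_{n-1}\gamma_{n+1}$ for all $n\ge 1$. *)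

theory Defs
  imports Complex_Main "HOL-Computational_Algebra.Polynomial"
begin

definition diag_op :: "(nat \<Rightarrow> real) \<Rightarrow> real poly \<Rightarrow> real poly" where
  "diag_op \<gamma> f = (\<Sum>n\<le>degree f. monom (\<gamma> n * coeff f n) n)"

lemma coeff_diag_op: "coeff (diag_op \<gamma> f) n = \<gamma> n * coeff f n"
proof -
  have "coeff (diag_op \<gamma> f) n = (\<Sum>k\<le>degree f. if k = n then \<gamma> k * coeff f k else 0)"
    by (simp add: diag_op_def coeff_sum)
  also have "\<dots> = \<gamma> n * coeff f n"
    by (simp add: coeff_eq_0)
  finally show ?thesis .
qed

lemma diag_op_add: "diag_op \<gamma> (f + g) = diag_op \<gamma> f + diag_op \<gamma> g"
  by (rule poly_eqI) (simp add: coeff_diag_op algebra_simps)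

lemma diag_op_smult: "diag_op \<gamma> (smult c f) = smult c (diag_op \<gamma> f)"
  by (rule poly_eqI) (simp add: coeff_diag_op algebra_simps)

lemma diag_op_monom: "diag_op \<gamma> (monom 1 n) = monom (\<gamma> n) n"
  by (rule poly_eqI) (simp add: coeff_diag_op)

lemma diag_op_unique:
  assumes add: "\<And>f g. T (f + g) = T f + T g"
    and smult: "\<And>c f. T (smult c f) = smult c (T f)"
    and monom: "\<And>n. T (monom 1 n) = monom (\<gamma> n) n"
  shows "T = diag_op \<gamma>"
proof
  fix f :: "real poly"
  have T0: "T 0 = 0"
    using smult[of 0 0] by simp
  have T_sum: "T (sum h A) = (\<Sum>x\<in>A. T (h x))" if "finite A" for h :: "nat \<Rightarrow> real poly" and A
    using that by (induction A) (simp_all add: T0 add)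
  have T_monom: "T (monom c n) = monom (\<gamma> n * c) n" for c n
    using smult[of c "monom 1 n"] monom[of n] by (simp add: smult_monom mult.commute)
  have "T f = T (\<Sum>n\<le>degree f. monom (coeff f n) n)"
    by (simp add: poly_as_sum_of_monoms)
  also have "\<dots> = diag_op \<gamma> f"
    by (simp add: T_sum T_monom diag_op_def)
  finally show "T f = diag_op \<gamma> f" .
qed

text \<open>
  The witness \<open>z = 0\<close> is allowed, with \<open>0 ^ 0 = 1\<close>; the index \<open>m\<close> may exceed the degree,
  in which case its coefficient is \<open>0\<close>. So if the constant coefficient of \<open>f\<close> vanishes,
  then every \<open>m \<ge> 1\<close> is a central index of \<open>f\<close>.
\<close>
definition central_index :: "real poly \<Rightarrow> nat \<Rightarrow> bool" where
  "central_index f m \<longleftrightarrow>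
     (\<exists>z\<ge>0. \<bar>coeff f m\<bar> * z ^ m \<ge> (\<Sum>n\<in>{..degree f} - {m}. \<bar>coeff f n\<bar> * z ^ n))"

text \<open>
  Only polynomials with nonnegative coefficients are considered. This is no restriction:
  replacing each coefficient of \<open>f\<close> by its absolute value changes the central indices
  neither of \<open>f\<close> nor of \<open>diag_op \<gamma> f\<close>.
\<close>
definition central_index_preserver :: "(nat \<Rightarrow> real) \<Rightarrow> bool" where
  "central_index_preserver \<gamma> \<longleftrightarrow>
     (\<forall>f. (\<forall>n. coeff f n \<ge> 0) \<longrightarrow>
        {m. central_index f m} \<subseteq> {m. central_index (diag_op \<gamma> f) m})"

definition log_concave :: "(nat \<Rightarrow> real) \<Rightarrow> bool" where
  "log_concave \<gamma> \<longleftrightarrow> (\<forall>n\<ge>1. (\<gamma> n)\<^sup>2 \<ge> \<gamma> (n - 1) * \<gamma> (n + 1))"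

end

theory Submission imports Defs begin

text \<open>
  For a log-concave \<open>\<gamma>\<close> and \<open>r = \<gamma> m / \<gamma> (m + 1)\<close>, the sequence \<open>\<gamma> n * r ^ n\<close> is
  largest at \<open>n = m\<close>, so if \<open>z\<close> witnesses that \<open>m\<close> is a central index of \<open>f\<close>, then \<open>r * z\<close>
  witnesses it for \<open>diag_op \<gamma> f\<close>. Conversely, \<open>k + 1\<close> is a central index of
  \<open>\<epsilon> + z^k + (2 + \<epsilon>) z^(k+1) + z^(k+2)\<close>, at \<open>z = 1\<close>. If it remains one after applying
  \<open>diag_op \<gamma>\<close>, then \<open>4 * \<gamma> k * \<gamma> (k+2) \<le> (2 + \<epsilon>)^2 * \<gamma> (k+1)^2\<close> by a discriminant
  estimate, and one lets \<open>\<epsilon>\<close> tend to \<open>0\<close>.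
\<close>

text \<open>With nonnegative coefficients the sum over \<open>n \<noteq> m\<close> is
  \<open>poly f z\<close> minus its term at \<open>m\<close>. This trades the punctured sum and the
  absolute values for plain evaluation.\<close>

lemma central_index_iff_poly:
  assumes "\<And>n. coeff f n \<ge> 0"
  shows "central_index f m \<longleftrightarrow> (\<exists>z\<ge>0. poly f z \<le> 2 * coeff f m * z ^ m)"
proof -
  have "(\<Sum>n\<in>{..degree f} - {m}. \<bar>coeff f n\<bar> * z ^ n) = poly f z - coeff f m * z ^ m" for z
    \<comment> \<open>Beyond the degree nothing is removed from the index set, and the subtracted
      term is \<open>0\<close>.\<close>
    by (cases "m \<le> degree f") (simp_all add: assms abs_of_nonneg poly_altdef sum_diff1 coeff_eq_0)
  then show ?thesis
    unfolding central_index_def by (simp only:) (simp add: assms diff_le_eq mult.assoc)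
qed

lemma log_concave_ratio_antimono:
  fixes \<gamma> :: "nat \<Rightarrow> real"
  assumes pos: "\<And>n. \<gamma> n > 0" and lc: "log_concave \<gamma>"
  shows "antimono (\<lambda>n. \<gamma> (Suc n) / \<gamma> n)"
proof (rule decseq_SucI)
  fix n
  have "\<gamma> n * \<gamma> (Suc (Suc n)) \<le> (\<gamma> (Suc n))\<^sup>2"
    using lc[unfolded log_concave_def, rule_format, of "Suc n"] by simp
  then show "\<gamma> (Suc (Suc n)) / \<gamma> (Suc n) \<le> \<gamma> (Suc n) / \<gamma> n"
    using pos[of n] pos[of "Suc n"] by (simp add: field_simps power2_eq_square)
qed

text \<open>The quotient of consecutive terms, \<open>r * \<gamma> (Suc n) / \<gamma> n\<close>, is
  antitone and equals \<open>1\<close> at \<open>n = m\<close>, so the terms rise up to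
  \<open>m\<close> and fall afterwards.\<close>

lemma log_concave_max_at:
  fixes \<gamma> :: "nat \<Rightarrow> real" and m :: nat
  assumes pos: "\<And>n. \<gamma> n > 0" and lc: "log_concave \<gamma>"
  defines "r \<equiv> \<gamma> m / \<gamma> (Suc m)"
  shows "\<gamma> n * r ^ n \<le> \<gamma> m * r ^ m"
proof -
  have r: "r > 0" by (simp add: r_def pos)
  have anti: "\<gamma> (Suc j) / \<gamma> j \<le> \<gamma> (Suc i) / \<gamma> i" if "i \<le> j" for i j
    using antimonoD[OF log_concave_ratio_antimono[OF pos lc] that] .
  have down: "\<gamma> (Suc i) * r \<le> \<gamma> i" if "m \<le> i" for i
    using anti[OF that] pos[of i] pos[of m] pos[of "Suc m"] by (simp add: r_def field_simps)
  have up: "\<gamma> i \<le> \<gamma> (Suc i) * r" if "i \<le> m" for i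
    using anti[OF that] pos[of i] pos[of m] pos[of "Suc m"] by (simp add: r_def field_simps)
  show ?thesis
  proof (cases "m \<le> n")
    case True
    then show ?thesis
    proof (induction n rule: dec_induct)
      case (step i)
      have "\<gamma> (Suc i) * r ^ Suc i = (\<gamma> (Suc i) * r) * r ^ i" by simp
      also have "\<dots> \<le> \<gamma> i * r ^ i" using down step r by (intro mult_right_mono) auto
      finally show ?case using step by linarith
    qed simp
  next
    case False
    then have "n \<le> m" by simp
    then show ?thesis
    proof (induction n rule: inc_induct)
      case (step i)
      have "\<gamma> i * r ^ i \<le> (\<gamma> (Suc i) * r) * r ^ i"
        using up step r by (intro mult_right_mono) auto
      then show ?case using step by (simp add: mult.assoc)
    qed simp
  qed
qed

lemma log_concave_imp_preserver:
  fixes \<gamma> :: "nat \<Rightarrow> real"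
  assumes pos: "\<And>n. \<gamma> n > 0" and lc: "log_concave \<gamma>"
  shows "central_index_preserver \<gamma>"
  unfolding central_index_preserver_def
proof (intro allI impI subsetI CollectI)
  fix f m
  assume nn: "\<forall>n. coeff f n \<ge> 0" and "m \<in> {m. central_index f m}"
  then obtain z where z: "z \<ge> 0" "poly f z \<le> 2 * coeff f m * z ^ m"
    by (auto simp: central_index_iff_poly)
  define r where "r = \<gamma> m / \<gamma> (Suc m)"
  have r: "r > 0" by (simp add: r_def pos)
  have "poly (diag_op \<gamma> f) (r * z) = (\<Sum>n\<le>degree f. (\<gamma> n * r ^ n) * (coeff f n * z ^ n))"
    by (simp add: diag_op_def poly_sum poly_monom power_mult_distrib ac_simps)
  also have "\<dots> \<le> (\<Sum>n\<le>degree f. (\<gamma> m * r ^ m) * (coeff f n * z ^ n))"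
    using log_concave_max_at[OF pos lc, of _ m] nn z(1)
    by (intro sum_mono mult_right_mono) (auto simp: r_def)
  also have "\<dots> = (\<gamma> m * r ^ m) * poly f z"
    by (simp add: poly_altdef sum_distrib_left)
  also have "\<dots> \<le> (\<gamma> m * r ^ m) * (2 * coeff f m * z ^ m)"
    using z(2) pos[of m] r by (intro mult_left_mono) auto
  also have "\<dots> = 2 * coeff (diag_op \<gamma> f) m * (r * z) ^ m"
    by (simp add: coeff_diag_op power_mult_distrib ac_simps)
  finally have "poly (diag_op \<gamma> f) (r * z) \<le> 2 * coeff (diag_op \<gamma> f) m * (r * z) ^ m" .
  moreover have "coeff (diag_op \<gamma> f) n \<ge> 0" for n
    using nn pos[of n] by (simp add: coeff_diag_op)
  ultimately show "central_index (diag_op \<gamma> f) m"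
    using z(1) r by (auto simp: central_index_iff_poly intro!: exI[of _ "r * z"])
qed

text \<open>This is the inequality of arithmetic and geometric means for \<open>a\<close> and
  \<open>c * x\<^sup>2\<close>; as their sum is nonnegative, the hypothesis may be squared whatever
  the sign of \<open>b\<close>.\<close>

lemma discriminant_bound:
  fixes a b c x :: real
  assumes "0 \<le> a" "0 \<le> c" "0 < x" and le: "a + c * x\<^sup>2 \<le> b * x"
  shows "4 * (a * c) \<le> b\<^sup>2"
proof -
  have "4 * (a * c) * x\<^sup>2 \<le> (a + c * x\<^sup>2)\<^sup>2"
    using zero_le_power2[of "a - c * x\<^sup>2"] by (simp add: power2_eq_square algebra_simps)
  also have "\<dots> \<le> (b * x)\<^sup>2"
    using le assms by (intro power_mono) auto
  finally have "4 * (a * c) * x\<^sup>2 \<le> b\<^sup>2 * x\<^sup>2" by (simp add: power_mult_distrib)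
  then show ?thesis using \<open>0 < x\<close> by simp
qed

lemma preserver_approx_log_concave:
  fixes \<gamma> :: "nat \<Rightarrow> real"
  assumes pos: "\<And>n. \<gamma> n > 0" and pres: "central_index_preserver \<gamma>" and \<epsilon>: "\<epsilon> > 0"
  shows "4 * (\<gamma> k * \<gamma> (Suc (Suc k))) \<le> ((2 + \<epsilon>) * \<gamma> (Suc k))\<^sup>2"
proof -
  text \<open>
    The constant term \<open>\<epsilon>\<close> excludes the witness \<open>z = 0\<close>, which would make \<open>Suc k\<close>
    trivially central when \<open>k > 0\<close>.
  \<close>
  define f where "f = smult \<epsilon> (monom 1 0) + monom 1 k
    + smult (2 + \<epsilon>) (monom 1 (Suc k)) + monom 1 (Suc (Suc k))"
  have nn: "coeff f n \<ge> 0" for n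
    using \<epsilon> by (simp add: f_def coeff_pCons split: nat.split)
  \<comment> \<open>Equality holds: the coefficients sum to \<open>4 + 2 * \<epsilon>\<close>, twice
    the middle one.\<close>
  have "poly f 1 \<le> 2 * coeff f (Suc k) * 1 ^ Suc k"
    by (simp add: f_def poly_monom)
  then have "central_index f (Suc k)"
    by (auto simp: central_index_iff_poly nn intro!: exI[of _ 1])
  then have "central_index (diag_op \<gamma> f) (Suc k)"
    using pres nn by (auto simp: central_index_preserver_def)
  moreover have "coeff (diag_op \<gamma> f) n \<ge> 0" for n
    using nn pos[of n] by (simp add: coeff_diag_op)
  ultimately obtain w where w: "w \<ge> 0"
    "poly (diag_op \<gamma> f) w \<le> 2 * coeff (diag_op \<gamma> f) (Suc k) * w ^ Suc k"
    by (auto simp: central_index_iff_poly)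
  \<comment> \<open>One of the two copies of the middle term cancels against the one in
    \<open>poly (diag_op \<gamma> f) w\<close>.\<close>
  have le: "\<epsilon> * \<gamma> 0 + \<gamma> k * w ^ k + \<gamma> (Suc (Suc k)) * w ^ Suc (Suc k)
      \<le> (2 + \<epsilon>) * \<gamma> (Suc k) * w ^ Suc k"
    using w(2) unfolding coeff_diag_op
    unfolding f_def diag_op_add diag_op_smult diag_op_monom
    by (simp add: poly_monom algebra_simps)
  have "\<epsilon> * \<gamma> 0 > 0" using \<epsilon> pos by simp
  have "w \<noteq> 0"
  proof
    assume "w = 0"
    moreover have "\<gamma> k * 0 ^ k \<ge> 0" using pos[of k] by simp
    ultimately show False using le \<open>\<epsilon> * \<gamma> 0 > 0\<close> by simp
  qed
  with w(1) have "w > 0" by simp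
  \<comment> \<open>The positive constant term has served to exclude \<open>w = 0\<close> and is now
    dropped.\<close>
  have "w ^ k * (\<gamma> k + \<gamma> (Suc (Suc k)) * w\<^sup>2) \<le> w ^ k * ((2 + \<epsilon>) * \<gamma> (Suc k) * w)"
    using le \<open>\<epsilon> * \<gamma> 0 > 0\<close> by (simp add: algebra_simps power2_eq_square)
  then have "\<gamma> k + \<gamma> (Suc (Suc k)) * w\<^sup>2 \<le> (2 + \<epsilon>) * \<gamma> (Suc k) * w"
    using \<open>w > 0\<close> by (simp only: mult_le_cancel_left_pos zero_less_power)
  then show ?thesis
    using \<open>w > 0\<close> pos[THEN less_imp_le] by (intro discriminant_bound) auto
qed

lemma preserver_imp_log_concave:
  fixes \<gamma> :: "nat \<Rightarrow> real"
  assumes pos: "\<And>n. \<gamma> n > 0" and pres: "central_index_preserver \<gamma>"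
  shows "log_concave \<gamma>"
proof -
  have "\<gamma> k * \<gamma> (Suc (Suc k)) \<le> (\<gamma> (Suc k))\<^sup>2" for k
  proof -
    \<comment> \<open>The limit is one-sided because the bound is available only for
      \<open>\<epsilon> > 0\<close>.\<close>
    have "((\<lambda>\<epsilon>. ((2 + \<epsilon>) * \<gamma> (Suc k))\<^sup>2) \<longlongrightarrow> ((2 + 0) * \<gamma> (Suc k))\<^sup>2) (at_right 0)"
      by (intro tendsto_intros)
    moreover have "\<forall>\<^sub>F \<epsilon> in at_right 0. 4 * (\<gamma> k * \<gamma> (Suc (Suc k))) \<le> ((2 + \<epsilon>) * \<gamma> (Suc k))\<^sup>2"
      using preserver_approx_log_concave[OF pos pres]
      by (auto intro: eventually_mono[OF eventually_at_right_less])
    ultimately have "4 * (\<gamma> k * \<gamma> (Suc (Suc k))) \<le> ((2 + 0) * \<gamma> (Suc k))\<^sup>2"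
      by (intro tendsto_lowerbound) auto
    then show ?thesis by (simp add: power_mult_distrib)
  qed
  then show ?thesis
    unfolding log_concave_def by (metis One_nat_def Suc_eq_plus1 Suc_le_D diff_Suc_1)
qed

theorem theorem2:
  fixes \<gamma> :: "nat \<Rightarrow> real"
  assumes pos: "\<And>n. \<gamma> n > 0"
  shows "central_index_preserver \<gamma> \<longleftrightarrow> log_concave \<gamma>"
  using log_concave_imp_preserver[of \<gamma>, OF pos] preserver_imp_log_concave[of \<gamma>, OF pos] by blast

end
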